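(* Let $m,n\ge 1$ and consider the system $$\dot r=P(t,r,\theta),\qquad \dot\theta=A(r)+Q(t,r,\theta),\qquad r\in\mathbf R^m_+,\ \theta\in\mathbf T^n,$$ where $A\in C^1(\mathbf R^m_+,\mathbf R^n)$ has all components $A_k(r)>0$, and $P\in C^{0,1,1}_{t,r,\theta}(\mathbf R\times\mathbf R^m_+\times\mathbf T^n,\mathbf R^m)$, $Q\in C^{0,1,1}_{t,r,\theta}(\mathbf R\times\mathbf R^m_+\times\mathbf T^n,\mathbf R^n)$. Suppose that for some real $p>1$ at least one of the following (equivalent) assumptions holds: (i) $t^p\|P(t,r,\theta)\|\to 0$ as $t\to+\infty$, uniformly with respect to $r$ in each compact subset of $\mathbf R^m_+$ and $\theta\in\mathbf T^n$; (ii) there are positive continuous scalar functions $\alpha(s)$, $\beta(t)$ with $\alpha$ increasing, $\beta$ decreasing, $\lim_{t\to\infty}\beta(t)=0$, and $t^p\|P(t,r,\theta)\|\le\alpha(\|r\|)\beta(t)$. Then the system has solutions bounded with respect to the $r$-coordinates; that is, there exist $t_0$ and a solution $(r(t),\theta(t))$ defined for all $t\ge t_0$ such that $\sup_{t\ge t_0}\|r(t)\|<\infty$.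
   Context: $\mathbf R_+=[0,+\infty)$, $\mathbf R^m_+=[0,+\infty)^m$, and $\mathbf T^n$ is the $n$-dimensional torus. Writing $\theta\in\mathbf T^n$ means that $\theta\in\mathbf R^n$ and the functions $P,Q$ are periodic (with constant period) in each component of $\theta$. $C^{0,1,1}_{t,r,\theta}$ denotes functions continuous in all variables and continuously differentiable with respect to $r$ and $\theta$. $\|\cdot\|$ is the Euclidean norm. Solutions take values in the domain $r\in\mathbf R^m_+$. *)

theory Defs
  imports "HOL-Analysis.Analysis"
begin

definition orthant :: "(real ^ 'm) set" where
  "orthant = {r. \<forall>i. 0 \<le> r $ i}"

text \<open>
  On the closed orthant, derivatives are taken relative to the orthant, i.e. they are one-sided
  in the inward coordinate directions at boundary points.
\<close>

definition C1_on_orthant :: "(real ^ 'm \<Rightarrow> real ^ 'k) \<Rightarrow> bool" where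
  "C1_on_orthant f \<longleftrightarrow>
     (\<exists>f' :: real ^ 'm \<Rightarrow> (real ^ 'm) \<Rightarrow>\<^sub>L (real ^ 'k).
        (\<forall>r\<in>orthant. (f has_derivative blinfun_apply (f' r)) (at r within orthant)) \<and>
        continuous_on orthant f')"

text \<open>
  The class \<open>C\<^sup>0\<^sup>,\<^sup>1\<^sup>,\<^sup>1\<close> in \<open>(t, r, \<theta>)\<close>: the function and its partial derivatives with respect to
  \<open>r\<close> and \<open>\<theta>\<close> are jointly continuous in all three variables.
\<close>

definition C011 :: "(real \<Rightarrow> real ^ 'm \<Rightarrow> real ^ 'n \<Rightarrow> real ^ 'k) \<Rightarrow> bool" where
  "C011 f \<longleftrightarrow>
     continuous_on (UNIV \<times> orthant \<times> UNIV) (\<lambda>(t, r, \<theta>). f t r \<theta>) \<and>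
     (\<exists>(Dr :: real \<Rightarrow> real ^ 'm \<Rightarrow> real ^ 'n \<Rightarrow> (real ^ 'm) \<Rightarrow>\<^sub>L (real ^ 'k))
       (D\<theta> :: real \<Rightarrow> real ^ 'm \<Rightarrow> real ^ 'n \<Rightarrow> (real ^ 'n) \<Rightarrow>\<^sub>L (real ^ 'k)).
        (\<forall>t. \<forall>r\<in>orthant. \<forall>\<theta>.
           ((\<lambda>x. f t x \<theta>) has_derivative blinfun_apply (Dr t r \<theta>)) (at r within orthant) \<and>
           ((\<lambda>y. f t r y) has_derivative blinfun_apply (D\<theta> t r \<theta>)) (at \<theta>)) \<and>
        continuous_on (UNIV \<times> orthant \<times> UNIV) (\<lambda>(t, r, \<theta>). Dr t r \<theta>) \<and>
        continuous_on (UNIV \<times> orthant \<times> UNIV) (\<lambda>(t, r, \<theta>). D\<theta> t r \<theta>))"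

text \<open>
  A function on the torus is a function on the covering space \<open>real ^ 'n\<close> that has the constant
  period \<open>\<omega> $ k\<close> in the \<open>k\<close>-th component.
\<close>

definition torus_periodic ::
    "real ^ 'n \<Rightarrow> (real \<Rightarrow> real ^ 'm \<Rightarrow> real ^ 'n \<Rightarrow> real ^ 'k) \<Rightarrow> bool" where
  "torus_periodic \<omega> f \<longleftrightarrow>
     (\<forall>t. \<forall>r\<in>orthant. \<forall>\<theta>. \<forall>k. f t r (\<theta> + axis k (\<omega> $ k)) = f t r \<theta>)"

definition decay_uniform ::
    "real \<Rightarrow> (real \<Rightarrow> real ^ 'm \<Rightarrow> real ^ 'n \<Rightarrow> real ^ 'k) \<Rightarrow> bool" where
  "decay_uniform p P \<longleftrightarrow>
     (\<forall>K. compact K \<and> K \<subseteq> orthant \<longrightarrow>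
        uniform_limit (K \<times> UNIV) (\<lambda>t (r, \<theta>). t powr p * norm (P t r \<theta>)) (\<lambda>_. 0) at_top)"

text \<open>
  The bound is required only for \<open>t \<ge> 0\<close>, since \<open>t\<^sup>p\<close> with real \<open>p\<close> has no meaning for negative
  \<open>t\<close>.  Monotonicity is non-strict.
\<close>

definition decay_majorant ::
    "real \<Rightarrow> (real \<Rightarrow> real ^ 'm \<Rightarrow> real ^ 'n \<Rightarrow> real ^ 'k) \<Rightarrow> bool" where
  "decay_majorant p P \<longleftrightarrow>
     (\<exists>\<alpha> \<beta> :: real \<Rightarrow> real.
        continuous_on {0..} \<alpha> \<and> (\<forall>s\<ge>0. 0 < \<alpha> s) \<and> mono_on {0..} \<alpha> \<and>
        continuous_on {0..} \<beta> \<and> (\<forall>t\<ge>0. 0 < \<beta> t) \<and> antimono_on {0..} \<beta> \<and>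
        (\<beta> \<longlongrightarrow> 0) at_top \<and>
        (\<forall>t\<ge>0. \<forall>r\<in>orthant. \<forall>\<theta>. t powr p * norm (P t r \<theta>) \<le> \<alpha> (norm r) * \<beta> t))"

definition solves_system ::
    "(real ^ 'm \<Rightarrow> real ^ 'n) \<Rightarrow>
     (real \<Rightarrow> real ^ 'm \<Rightarrow> real ^ 'n \<Rightarrow> real ^ 'm) \<Rightarrow>
     (real \<Rightarrow> real ^ 'm \<Rightarrow> real ^ 'n \<Rightarrow> real ^ 'n) \<Rightarrow>
     real \<Rightarrow> (real \<Rightarrow> real ^ 'm) \<Rightarrow> (real \<Rightarrow> real ^ 'n) \<Rightarrow> bool" where
  "solves_system A P Q t0 r \<theta> \<longleftrightarrow>
     (\<forall>t\<ge>t0. r t \<in> orthant \<and>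
        (r has_vector_derivative P t (r t) (\<theta> t)) (at t within {t0..}) \<and>
        (\<theta> has_vector_derivative A (r t) + Q t (r t) (\<theta> t)) (at t within {t0..}))"

end

theory Submission
  imports Defs
begin

text \<open>
  Start at \<open>r = (1, \<dots>, 1)\<close> and let \<open>K\<close> be the ball of radius \<open>1/2\<close> around this point, which lies in
  the orthant.  Precomposing the right-hand side with the nearest-point projection onto \<open>K\<close> in the
  variable \<open>r\<close> gives a system on the whole space which, by periodicity in \<open>\<theta>\<close>, is globally Lipschitz on
  each bounded time interval, so Picard iteration solves it on \<open>[t0, \<infinity>)\<close>.  Since
  \<open>\<parallel>P\<parallel> \<le> t\<^sup>-\<^sup>p\<close> on \<open>K\<close> for large \<open>t\<close> and \<open>p > 1\<close>, for large \<open>t0\<close> the total variation of \<open>r\<close> is at most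
  \<open>1/2\<close>; so \<open>r\<close> stays in \<open>K\<close>, where the modified and the original systems agree.
\<close>

section \<open>Global existence for Lipschitz equations on a half-line, by Picard iteration\<close>

lemma integral_has_vector_derivative_at_least:
  fixes g :: "real \<Rightarrow> 'a::banach"
  assumes "continuous_on {a..} g" and "a \<le> t"
  shows "((\<lambda>u. integral {a..u} g) has_vector_derivative g t) (at t within {a..})"
proof -
  have "continuous_on {a..t+1} g"
    using assms(1) by (rule continuous_on_subset) auto
  then have "((\<lambda>u. integral {a..u} g) has_vector_derivative g t) (at t within {a..t+1})"
    using assms(2) by (intro integral_has_vector_derivative) auto
  \<comment> \<open>Derivatives are local: inside the neighbourhood \<open>{..<t+1}\<close> of
    \<open>t\<close> the two sets coincide.\<close>
  moreover have "at t within {a..t+1} = at t within {a..}"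
    using assms(2) by (intro at_within_nhd[of _ "{..<t+1}"]) auto
  ultimately show ?thesis
    by simp
qed

text \<open>The right-hand side is an antiderivative that vanishes at \<open>a\<close>. This is the
  induction step of the Picard estimate: each integration raises the power by one and supplies the
  next factor of the factorial.\<close>

lemma integral_monomial_at_least:
  fixes a t L :: real
  assumes "a \<le> t"
  shows "((\<lambda>s. L * (M * (L * (s - a)) ^ n / fact n)) has_integral
            M * (L * (t - a)) ^ Suc n / fact (Suc n)) {a..t}"
proof -
  have "((\<lambda>s. M * (L * (s - a)) ^ Suc n / fact (Suc n)) has_real_derivative
            L * (M * (L * (s - a)) ^ n / fact n)) (at s within {a..t})" for s
  proof -
    have "((\<lambda>s. M * (L * (s - a)) ^ Suc n / fact (Suc n)) has_real_derivative
            M * (real (Suc n) * (L * (s - a)) ^ n * L) / fact (Suc n)) (at s within {a..t})"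
      by (rule derivative_eq_intros | simp)+
    moreover have "M * (real (Suc n) * (L * (s - a)) ^ n * L) / fact (Suc n)
                     = L * (M * (L * (s - a)) ^ n / fact n)"
      by (simp add: fact_Suc divide_simps del: of_nat_Suc)
    ultimately show ?thesis
      by (simp only:)
  qed
  then have "((\<lambda>s. L * (M * (L * (s - a)) ^ n / fact n)) has_integral
            M * (L * (t - a)) ^ Suc n / fact (Suc n) - M * (L * (a - a)) ^ Suc n / fact (Suc n)) {a..t}"
    by (intro fundamental_theorem_of_calculus assms)
       (simp add: has_real_derivative_iff_has_vector_derivative)
  then show ?thesis
    by simp
qed

text \<open>The Lipschitz constant may grow with \<open>T\<close>, yet no gluing of short-time
  solutions is required: the factorials in the estimate of successive iterates give uniform
  convergence on every interval \<open>{t0..T}\<close>, however long.\<close>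

lemma global_solution_of_lipschitz_ode:
  fixes F :: "real \<Rightarrow> 'a::banach \<Rightarrow> 'a"
  assumes cont: "continuous_on ({t0..} \<times> UNIV) (\<lambda>(t, x). F t x)"
    and lip: "\<And>T. \<exists>L. \<forall>t\<in>{t0..T}. \<forall>x y. norm (F t x - F t y) \<le> L * norm (x - y)"
  obtains x where "x t0 = x0"
    and "\<And>t. t0 \<le> t \<Longrightarrow> (x has_vector_derivative F t (x t)) (at t within {t0..})"
proof -
  define X where "X = rec_nat (\<lambda>_. x0) (\<lambda>_ y t. x0 + integral {t0..t} (\<lambda>s. F s (y s)))"
  have X0: "X 0 = (\<lambda>_. x0)" and XS: "X (Suc n) t = x0 + integral {t0..t} (\<lambda>s. F s (X n s))" for n t
    by (simp_all add: X_def)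
  have contF: "continuous_on {t0..} (\<lambda>s. F s (y s))" if "continuous_on {t0..} y" for y
  proof -
    have "continuous_on {t0..} (\<lambda>s. case (s, y s) of (t, x) \<Rightarrow> F t x)"
      by (rule continuous_on_compose2[OF cont]) (auto intro!: continuous_on_Pair that)
    then show ?thesis by simp
  qed
  have contX: "continuous_on {t0..} (X n)" for n
  proof (induction n)
    case 0
    then show ?case by (simp add: X0)
  next
    case (Suc n)
    have "continuous_on {t0..} (\<lambda>t. integral {t0..t} (\<lambda>s. F s (X n s)))"
      using integral_has_vector_derivative_at_least[OF contF[OF Suc]]
      by (intro continuous_on_vector_derivative) auto
    then show ?case
      unfolding XS[abs_def] by (intro continuous_intros)
  qed
  have int: "(\<lambda>s. F s (y s)) integrable_on {t0..t}" if "continuous_on {t0..} y" for t y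
    by (rule integrable_continuous_real, rule continuous_on_subset[OF contF[OF that]]) auto
  \<comment> \<open>The limit of the iterates is written as a telescoping series so that the
    Weierstrass M-test applies; the formula does not involve \<open>T\<close>.\<close>
  define x where "x t = x0 + (\<Sum>n. X (Suc n) t - X n t)" for t
  have unif: "uniform_limit {t0..T} X x sequentially" for T
  proof -
    obtain L where "\<And>t x y. t \<in> {t0..T} \<Longrightarrow> norm (F t x - F t y) \<le> L * norm (x - y)"
      using lip by blast
    \<comment> \<open>Nothing fixes the sign of \<open>L\<close>; a nonnegative constant is wanted
      for multiplying inequalities.\<close>
    moreover define K where "K = max L 0"
    ultimately have L: "norm (F t x - F t y) \<le> K * norm (x - y)" if "t \<in> {t0..T}" for t x y
      using that by (meson max.cobounded1 mult_right_mono norm_ge_zero order_trans)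
    have "K \<ge> 0" by (simp add: K_def)
    have "bounded ((\<lambda>t. X (Suc 0) t - X 0 t) ` {t0..T})"
      by (intro compact_imp_bounded compact_continuous_image continuous_intros
          continuous_on_subset[OF contX]) auto
    then obtain M where M: "\<And>t. t \<in> {t0..T} \<Longrightarrow> norm (X (Suc 0) t - X 0 t) \<le> M"
      unfolding bounded_iff ball_simps by blast
    have est: "norm (X (Suc n) t - X n t) \<le> M * (K * (t - t0)) ^ n / fact n" if "t \<in> {t0..T}" for n t
      using that
    proof (induction n arbitrary: t)
      case 0
      then show ?case using M[of t] by simp
    next
      case (Suc n)
      have "X (Suc (Suc n)) t - X (Suc n) t
              = integral {t0..t} (\<lambda>s. F s (X (Suc n) s) - F s (X n s))"
        using XS[of "Suc n" t] XS[of n t] by (subst integral_diff) (auto intro: int contX)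
      also have "norm \<dots> \<le> integral {t0..t} (\<lambda>s. K * (M * (K * (s - t0)) ^ n / fact n))"
      proof (rule integral_norm_bound_integral)
        show "(\<lambda>s. F s (X (Suc n) s) - F s (X n s)) integrable_on {t0..t}"
          by (intro integrable_diff int contX)
        show "(\<lambda>s. K * (M * (K * (s - t0)) ^ n / fact n)) integrable_on {t0..t}"
          by (rule has_integral_integrable, rule integral_monomial_at_least) (use Suc.prems in auto)
        fix s assume "s \<in> {t0..t}"
        then have s: "s \<in> {t0..T}" using Suc.prems by auto
        show "norm (F s (X (Suc n) s) - F s (X n s)) \<le> K * (M * (K * (s - t0)) ^ n / fact n)"
          using L[OF s] mult_left_mono[OF Suc.IH[OF s] \<open>K \<ge> 0\<close>] by (meson order_trans)
      qed
      also have "\<dots> = M * (K * (t - t0)) ^ Suc n / fact (Suc n)"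
        using integral_monomial_at_least Suc.prems by (intro integral_unique) auto
      finally show ?case .
    qed
    \<comment> \<open>The M-test wants a bound independent of \<open>t\<close>; here it is a
      multiple of a term of the exponential series.\<close>
    have est': "norm (X (Suc n) t - X n t) \<le> \<bar>M\<bar> * (inverse (fact n) * (K * \<bar>T - t0\<bar>) ^ n)"
      if "t \<in> {t0..T}" for n t
    proof -
      have "M * (K * (t - t0)) ^ n \<le> \<bar>M\<bar> * (K * \<bar>T - t0\<bar>) ^ n"
        using that \<open>K \<ge> 0\<close> by (intro mult_mono power_mono mult_nonneg_nonneg) auto
      then have "M * (K * (t - t0)) ^ n / fact n \<le> \<bar>M\<bar> * (K * \<bar>T - t0\<bar>) ^ n / fact n"
        by (intro divide_right_mono) auto
      with est[OF that, of n] show ?thesis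
        by (simp add: field_simps)
    qed
    have "uniform_limit {t0..T} (\<lambda>n t. \<Sum>i<n. X (Suc i) t - X i t)
            (\<lambda>t. \<Sum>i. X (Suc i) t - X i t) sequentially"
      using est' by (rule Weierstrass_m_test) (auto intro: summable_mult summable_exp)
    then have "uniform_limit {t0..T} (\<lambda>n t. x0 + (\<Sum>i<n. X (Suc i) t - X i t)) x sequentially"
      unfolding x_def by (intro uniform_limit_intros)
    moreover have "x0 + (\<Sum>i<n. X (Suc i) t - X i t) = X n t" for n t
      using sum_lessThan_telescope[of "\<lambda>i. X i t" n] by (simp add: X0)
    ultimately show ?thesis by simp
  qed
  have contx: "continuous_on {t0..} x"
  proof -
    have "continuous (at t within {t0..}) x" if "t0 \<le> t" for t
    proof -
      have "continuous_on {t0..t+1} x"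
        by (rule uniform_limit_theorem[OF always_eventually unif])
           (auto intro: continuous_on_subset[OF contX])
      then have "continuous (at t within {t0..t+1}) x"
        using that by (simp add: continuous_on_eq_continuous_within)
      moreover have "at t within {t0..t+1} = at t within {t0..}"
        using that by (intro at_within_nhd[of _ "{..<t+1}"]) auto
      ultimately show ?thesis by simp
    qed
    then show ?thesis
      by (simp add: continuous_on_eq_continuous_within)
  qed
  have x: "x t = x0 + integral {t0..t} (\<lambda>s. F s (x s))" if "t0 \<le> t" for t
  proof -
    obtain L where "\<And>s x y. s \<in> {t0..t} \<Longrightarrow> norm (F s x - F s y) \<le> L * norm (x - y)"
      using lip by blast
    then have "uniform_limit {t0..t} (\<lambda>n s. F s (X n s)) (\<lambda>s. F s (x s)) sequentially"
      unfolding uniform_limit_iff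
    proof (intro allI impI)
      fix e :: real assume "e > 0"
      \<comment> \<open>Dividing by \<open>\<bar>L\<bar> + 1\<close> keeps the threshold positive
        and finite for every real \<open>L\<close>, zero included.\<close>
      have "\<forall>\<^sub>F n in sequentially. \<forall>s\<in>{t0..t}. dist (X n s) (x s) < e / (\<bar>L\<bar> + 1)"
        using \<open>e > 0\<close> by (intro uniform_limitD[OF unif]) (auto intro: divide_pos_pos)
      then show "\<forall>\<^sub>F n in sequentially. \<forall>s\<in>{t0..t}. dist (F s (X n s)) (F s (x s)) < e"
      proof (eventually_elim, intro ballI)
        fix n s assume n: "\<forall>s\<in>{t0..t}. dist (X n s) (x s) < e / (\<bar>L\<bar> + 1)" and s: "s \<in> {t0..t}"
        have "dist (F s (X n s)) (F s (x s)) \<le> L * dist (X n s) (x s)"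
          using s \<open>\<And>s x y. s \<in> {t0..t} \<Longrightarrow> norm (F s x - F s y) \<le> L * norm (x - y)\<close>
          by (simp add: dist_norm)
        also have "\<dots> \<le> (\<bar>L\<bar> + 1) * dist (X n s) (x s)"
          by (intro mult_right_mono) auto
        also have "\<dots> < e"
          using n s by (auto simp: field_simps)
        finally show "dist (F s (X n s)) (F s (x s)) < e" .
      qed
    qed
    then obtain I J where IJ: "\<And>n. ((\<lambda>s. F s (X n s)) has_integral I n) {t0..t}"
      "((\<lambda>s. F s (x s)) has_integral J) {t0..t}" "I \<longlonglongrightarrow> J"
      by (rule uniform_limit_integral)
         (auto intro: continuous_on_subset[OF contF[OF contX]])
    \<comment> \<open>Passing to the limit on both sides of the Picard recursion gives the integral
      equation, by uniqueness of limits.\<close>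
    have "(\<lambda>n. X (Suc n) t) \<longlonglongrightarrow> x0 + integral {t0..t} (\<lambda>s. F s (x s))"
      unfolding XS integral_unique[OF IJ(1)] integral_unique[OF IJ(2)]
      by (intro tendsto_intros IJ(3))
    moreover have "(\<lambda>n. X (Suc n) t) \<longlonglongrightarrow> x t"
      using unif[of t] that by (intro LIMSEQ_Suc tendsto_uniform_limitI) auto
    ultimately show ?thesis by (rule LIMSEQ_unique[rotated])
  qed
  show thesis
  proof
    show "x t0 = x0"
      using x[of t0] by simp
    fix t assume t: "t0 \<le> t"
    have "((\<lambda>t. x0 + integral {t0..t} (\<lambda>s. F s (x s))) has_vector_derivative F t (x t))
            (at t within {t0..})"
      using integral_has_vector_derivative_at_least[OF contF[OF contx] t]
      by (auto intro!: derivative_eq_intros)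
    then show "(x has_vector_derivative F t (x t)) (at t within {t0..})"
      by (rule has_vector_derivative_transform[rotated 2]) (use t x in auto)
  qed
qed

section \<open>Periodicity in the angles and Lipschitz bounds that are uniform in them\<close>

lemma torus_periodic_axis_shift:
  assumes "torus_periodic \<omega> f" and "r \<in> orthant"
  shows "f t r (\<theta> + axis k (of_int j * \<omega> $ k)) = f t r \<theta>"
proof -
  have nat: "f t r (\<theta> + axis k (of_nat n * \<omega> $ k)) = f t r \<theta>" for n \<theta>
  proof (induction n)
    case (Suc n)
    have "\<theta> + axis k (of_nat (Suc n) * \<omega> $ k) = (\<theta> + axis k (of_nat n * \<omega> $ k)) + axis k (\<omega> $ k)"
      by (simp add: vec_eq_iff axis_def algebra_simps)
    then show ?case
      using assms Suc by (simp only: torus_periodic_def)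
  qed (simp add: axis_def flip: zero_vec_def)
  show ?thesis
  proof (cases "j \<ge> 0")
    case True
    then show ?thesis using nat[of \<theta> "nat j"] by simp
  next
    case False
    \<comment> \<open>For negative \<open>j\<close>, start from the shifted point: a natural
      multiple of the period leads back to \<open>\<theta>\<close>.\<close>
    have "\<theta> + axis k (of_int j * \<omega> $ k) + axis k (of_nat (nat (- j)) * \<omega> $ k) = \<theta>"
      using False by (simp add: vec_eq_iff axis_def algebra_simps)
    then show ?thesis
      using nat[of "\<theta> + axis k (of_int j * \<omega> $ k)" "nat (- j)"] by metis
  qed
qed

text \<open>A lattice vector is the sum of its components along the axes, and these are added one at
  a time by induction on the set of coordinates.\<close>

lemma torus_periodic_lattice_shift:
  fixes f :: "real \<Rightarrow> real ^ 'm \<Rightarrow> real ^ 'n \<Rightarrow> real ^ 'k"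
  assumes "torus_periodic \<omega> f" and "r \<in> orthant"
  shows "f t r (\<theta> + (\<chi> k. of_int (z k) * \<omega> $ k)) = f t r \<theta>"
proof -
  have "f t r (\<theta> + (\<Sum>k\<in>S. axis k (of_int (z k) * \<omega> $ k))) = f t r \<theta>" if "finite S"
    for S :: "'n set"
    using that
  proof (induction S)
    case (insert k S)
    have "\<theta> + (\<Sum>k\<in>insert k S. axis k (of_int (z k) * \<omega> $ k))
            = (\<theta> + (\<Sum>k\<in>S. axis k (of_int (z k) * \<omega> $ k))) + axis k (of_int (z k) * \<omega> $ k)"
      using insert.hyps by (simp add: algebra_simps)
    then show ?case
      using insert.IH torus_periodic_axis_shift[OF assms] by (simp only:)
  qed simp
  moreover have "(\<Sum>k\<in>UNIV. axis k (of_int (z k) * \<omega> $ k)) = (\<chi> k. of_int (z k) * \<omega> $ k)"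
    by (simp add: vec_eq_iff axis_def)
  ultimately show ?thesis
    using finite_class.finite_UNIV by (metis (no_types, lifting))
qed

text \<open>Subtracting in each coordinate the integer part of
  \<open>\<theta> $ k / \<omega> $ k\<close> periods leaves a remainder in one period cell.\<close>

lemma torus_representative:
  fixes \<theta> \<omega> :: "real ^ 'n"
  assumes "\<forall>k. 0 < \<omega> $ k"
  obtains z :: "'n \<Rightarrow> int" where "\<theta> + (\<chi> k. of_int (z k) * \<omega> $ k) \<in> cbox 0 \<omega>"
proof
  show "\<theta> + (\<chi> k. of_int (- \<lfloor>\<theta> $ k / \<omega> $ k\<rfloor>) * \<omega> $ k) \<in> cbox 0 \<omega>"
    unfolding mem_box_cart
  proof
    fix k
    have "0 < \<omega> $ k" using assms by simp
    from floor_divide_lower[OF this, of "\<theta> $ k"] floor_divide_upper[OF this, of "\<theta> $ k"]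
    show "0 $ k \<le> (\<theta> + (\<chi> k. of_int (- \<lfloor>\<theta> $ k / \<omega> $ k\<rfloor>) * \<omega> $ k)) $ k \<and>
        (\<theta> + (\<chi> k. of_int (- \<lfloor>\<theta> $ k / \<omega> $ k\<rfloor>) * \<omega> $ k)) $ k \<le> \<omega> $ k"
      by (simp add: algebra_simps)
  qed
qed

text \<open>On the compact set \<open>{a..b} \<times> K \<times> cbox 0 \<omega>\<close> the
  continuous derivatives are bounded, and periodicity extends the bounds to all angles. The mean
  value inequality is then applied in \<open>r\<close> (on the convex set \<open>K\<close>) and in
  \<open>\<theta>\<close> separately, and the two increments are added.\<close>

lemma C011_lipschitz:
  fixes f :: "real \<Rightarrow> real ^ 'm \<Rightarrow> real ^ 'n \<Rightarrow> real ^ 'k"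
  assumes "C011 f" and per: "torus_periodic \<omega> f" and \<omega>: "\<forall>k. 0 < \<omega> $ k"
    and "compact K" "convex K" and K: "K \<subseteq> orthant"
  shows "\<exists>L\<ge>0. \<forall>t\<in>{a..b}. \<forall>r\<in>K. \<forall>r'\<in>K. \<forall>\<theta> \<theta>'.
           norm (f t r \<theta> - f t r' \<theta>') \<le> L * (norm (r - r') + norm (\<theta> - \<theta>'))"
proof -
  obtain Dr D\<theta>
    where Dr: "\<And>t r \<theta>. r \<in> orthant \<Longrightarrow>
        ((\<lambda>x. f t x \<theta>) has_derivative blinfun_apply (Dr t r \<theta>)) (at r within orthant)"
      and D\<theta>: "\<And>t r \<theta>. r \<in> orthant \<Longrightarrow>
        ((\<lambda>y. f t r y) has_derivative blinfun_apply (D\<theta> t r \<theta>)) (at \<theta>)"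
      and contr: "continuous_on (UNIV \<times> orthant \<times> UNIV) (\<lambda>(t, r, \<theta>). Dr t r \<theta>)"
      and cont\<theta>: "continuous_on (UNIV \<times> orthant \<times> UNIV) (\<lambda>(t, r, \<theta>). D\<theta> t r \<theta>)"
    using assms(1) unfolding C011_def by blast
  have "compact ({a..b} \<times> K \<times> cbox 0 \<omega>)"
    using \<open>compact K\<close> by (intro compact_Times) auto
  moreover have "{a..b} \<times> K \<times> cbox 0 \<omega> \<subseteq> UNIV \<times> orthant \<times> UNIV"
    using K by auto
  ultimately have "bounded ((\<lambda>(t, r, \<theta>). Dr t r \<theta>) ` ({a..b} \<times> K \<times> cbox 0 \<omega>))"
    "bounded ((\<lambda>(t, r, \<theta>). D\<theta> t r \<theta>) ` ({a..b} \<times> K \<times> cbox 0 \<omega>))"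
    by (auto intro!: compact_imp_bounded compact_continuous_image continuous_on_subset[OF contr]
        continuous_on_subset[OF cont\<theta>])
  then obtain B1 B2 where
    B1: "\<forall>y\<in>(\<lambda>(t, r, \<theta>). Dr t r \<theta>) ` ({a..b} \<times> K \<times> cbox 0 \<omega>). norm y \<le> B1" and
    B2: "\<forall>y\<in>(\<lambda>(t, r, \<theta>). D\<theta> t r \<theta>) ` ({a..b} \<times> K \<times> cbox 0 \<omega>). norm y \<le> B2"
    unfolding bounded_iff by blast
  \<comment> \<open>The entry 0 guarantees \<open>L \<ge> 0\<close> even when the compact set is
    empty and \<open>B1\<close>, \<open>B2\<close> are arbitrary.\<close>
  define L where "L = Max {0, B1, B2}"
  have Dr_le: "onorm (blinfun_apply (Dr t r \<theta>)) \<le> L" and D\<theta>_le: "onorm (blinfun_apply (D\<theta> t r \<theta>)) \<le> L"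
    if "t \<in> {a..b}" "r \<in> K" "\<theta> \<in> cbox 0 \<omega>" for t r \<theta>
  proof -
    have "norm (Dr t r \<theta>) \<le> B1" using bspec[OF B1, of "Dr t r \<theta>"] that by force
    then show "onorm (blinfun_apply (Dr t r \<theta>)) \<le> L" by (simp add: L_def norm_blinfun.rep_eq)
    have "norm (D\<theta> t r \<theta>) \<le> B2" using bspec[OF B2, of "D\<theta> t r \<theta>"] that by force
    then show "onorm (blinfun_apply (D\<theta> t r \<theta>)) \<le> L" by (simp add: L_def norm_blinfun.rep_eq)
  qed
  have lip_r: "norm (f t r \<theta> - f t r' \<theta>) \<le> L * norm (r - r')"
    if "t \<in> {a..b}" "r \<in> K" "r' \<in> K" for t r r' \<theta>
  proof -
    \<comment> \<open>Both values of \<open>f\<close> have the same angle, so a single lattice shift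
      moves the whole segment from \<open>r\<close> to \<open>r'\<close> into the period
      cell.\<close>
    obtain z where z: "\<theta> + (\<chi> k. of_int (z k) * \<omega> $ k) \<in> cbox 0 \<omega>"
      using torus_representative[OF \<omega>] .
    define \<theta>' where "\<theta>' = \<theta> + (\<chi> k. of_int (z k) * \<omega> $ k)"
    have "f t x \<theta>' = f t x \<theta>" if "x \<in> K" for x
      unfolding \<theta>'_def by (rule torus_periodic_lattice_shift[OF per]) (use that K in auto)
    moreover have "norm (f t r \<theta>' - f t r' \<theta>') \<le> L * norm (r - r')"
    proof (rule differentiable_bound[OF \<open>convex K\<close>])
      fix x assume x: "x \<in> K"
      show "((\<lambda>x. f t x \<theta>') has_derivative blinfun_apply (Dr t x \<theta>')) (at x within K)"
        by (rule has_derivative_subset[OF Dr K]) (use x K in auto)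
      show "onorm (blinfun_apply (Dr t x \<theta>')) \<le> L"
        using that x z by (intro Dr_le) (auto simp: \<theta>'_def)
    qed (use that in auto)
    ultimately show ?thesis using that by simp
  qed
  have lip_\<theta>: "norm (f t r \<theta> - f t r \<theta>') \<le> L * norm (\<theta> - \<theta>')" if t: "t \<in> {a..b}" "r \<in> K" for t r \<theta> \<theta>'
  proof -
    \<comment> \<open>Two different angles need not reach the cell by the same shift, so the
      derivative is transported pointwise: \<open>f t r\<close> equals its own translate by
      \<open>c\<close>, hence the derivative at \<open>y + c\<close>, where the bound is known, is
      also one at \<open>y\<close>.\<close>
    have "\<exists>D. (f t r has_derivative D) (at y) \<and> onorm D \<le> L" for y
    proof -
      obtain z where z: "y + (\<chi> k. of_int (z k) * \<omega> $ k) \<in> cbox 0 \<omega>"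
        using torus_representative[OF \<omega>] .
      define c where "c = (\<chi> k. of_int (z k) * \<omega> $ k)"
      have "((\<lambda>x. x + c) has_derivative (\<lambda>h. h)) (at y)"
        by (auto intro!: derivative_eq_intros)
      moreover have "(f t r has_derivative blinfun_apply (D\<theta> t r (y + c))) (at (y + c))"
        using D\<theta> t K by blast
      ultimately have "((\<lambda>x. f t r (x + c)) has_derivative blinfun_apply (D\<theta> t r (y + c))) (at y)"
        by (rule has_derivative_compose)
      moreover have "f t r (x + c) = f t r x" for x
        unfolding c_def by (rule torus_periodic_lattice_shift[OF per]) (use t K in auto)
      ultimately show ?thesis
        using D\<theta>_le[OF t z] by (auto simp: c_def)
    qed
    then obtain D where "\<And>y. (f t r has_derivative D y) (at y)" "\<And>y. onorm (D y) \<le> L"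
      by metis
    then show ?thesis
      by (intro differentiable_bound[of UNIV]) auto
  qed
  have "norm (f t r \<theta> - f t r' \<theta>') \<le> L * (norm (r - r') + norm (\<theta> - \<theta>'))"
    if "t \<in> {a..b}" "r \<in> K" "r' \<in> K" for t r r' \<theta> \<theta>'
  proof -
    have "norm (f t r \<theta> - f t r' \<theta>') \<le> norm (f t r \<theta> - f t r' \<theta>) + norm (f t r' \<theta> - f t r' \<theta>')"
      by (metis add_diff_cancel_left' add_diff_eq diff_add_cancel norm_triangle_ineq)
    also have "\<dots> \<le> L * norm (r - r') + L * norm (\<theta> - \<theta>')"
      using that by (intro add_mono lip_r lip_\<theta>)
    finally show ?thesis by (simp add: distrib_left)
  qed
  moreover have "L \<ge> 0" by (simp add: L_def)
  ultimately show ?thesis by blast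
qed

text \<open>Puts the right-hand side of the angular equation in the same class as \<open>P\<close>,
  so that one Lipschitz lemma serves both equations.\<close>

lemma C011_autonomous_add:
  fixes A :: "real ^ 'm \<Rightarrow> real ^ 'k" and Q :: "real \<Rightarrow> real ^ 'm \<Rightarrow> real ^ 'n \<Rightarrow> real ^ 'k"
  assumes "C1_on_orthant A" and "C011 Q"
  shows "C011 (\<lambda>t r \<theta>. A r + Q t r \<theta>)"
proof -
  obtain A' where A': "\<And>r. r \<in> orthant \<Longrightarrow> (A has_derivative blinfun_apply (A' r)) (at r within orthant)"
    and contA': "continuous_on orthant A'"
    using assms(1) unfolding C1_on_orthant_def by blast
  have contA: "continuous_on orthant A"
    using A' by (rule has_derivative_continuous_on)
  obtain Dr D\<theta>
    where contQ: "continuous_on (UNIV \<times> orthant \<times> UNIV) (\<lambda>(t, r, \<theta>). Q t r \<theta>)"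
      and Dr: "\<And>t r \<theta>. r \<in> orthant \<Longrightarrow>
        ((\<lambda>x. Q t x \<theta>) has_derivative blinfun_apply (Dr t r \<theta>)) (at r within orthant)"
      and D\<theta>: "\<And>t r \<theta>. r \<in> orthant \<Longrightarrow>
        ((\<lambda>y. Q t r y) has_derivative blinfun_apply (D\<theta> t r \<theta>)) (at \<theta>)"
      and contr: "continuous_on (UNIV \<times> orthant \<times> UNIV) (\<lambda>(t, r, \<theta>). Dr t r \<theta>)"
      and cont\<theta>: "continuous_on (UNIV \<times> orthant \<times> UNIV) (\<lambda>(t, r, \<theta>). D\<theta> t r \<theta>)"
    using assms(2) unfolding C011_def by blast
  have proj: "continuous_on (UNIV \<times> orthant \<times> UNIV) (\<lambda>(t::real, r, \<theta>::real ^ 'n). g r)"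
    if "continuous_on orthant g" for g :: "real ^ 'm \<Rightarrow> 'b::topological_space"
    using continuous_on_compose2[OF that, of "UNIV \<times> orthant \<times> UNIV" "\<lambda>x. fst (snd x)"]
    by (force simp: case_prod_unfold intro!: continuous_intros)
  show ?thesis
    unfolding C011_def
  proof (intro conjI exI allI ballI)
    show "continuous_on (UNIV \<times> orthant \<times> UNIV) (\<lambda>(t, r, \<theta>). A r + Q t r \<theta>)"
      using continuous_on_add[OF proj[OF contA] contQ] by (simp add: case_prod_unfold)
    show "((\<lambda>x. A x + Q t x \<theta>) has_derivative blinfun_apply (A' r + Dr t r \<theta>)) (at r within orthant)"
      if "r \<in> orthant" for t r \<theta>
      using has_derivative_add[OF A'[OF that] Dr[OF that]] by (simp add: plus_blinfun.rep_eq)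
    show "((\<lambda>y. A r + Q t r y) has_derivative blinfun_apply (D\<theta> t r \<theta>)) (at \<theta>)"
      if "r \<in> orthant" for t r \<theta>
      using has_derivative_add[OF has_derivative_const D\<theta>[OF that]] by simp
    show "continuous_on (UNIV \<times> orthant \<times> UNIV) (\<lambda>(t, r, \<theta>). A' r + Dr t r \<theta>)"
      using continuous_on_add[OF proj[OF contA'] contr] by (simp add: case_prod_unfold)
    show "continuous_on (UNIV \<times> orthant \<times> UNIV) (\<lambda>(t, r, \<theta>). D\<theta> t r \<theta>)"
      by (rule cont\<theta>)
  qed
qed

section \<open>Decay of \<open>P\<close> and the resulting bound on the displacement of
  \<open>r\<close>\<close>

lemma norm_increment_le_powr_tail:
  fixes r :: "real \<Rightarrow> 'a::real_normed_vector"
  assumes "0 < t0" "t0 \<le> t" "1 < p"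
    and r: "\<And>s. t0 \<le> s \<Longrightarrow> (r has_vector_derivative v s) (at s within {t0..})"
    and v: "\<And>s. t0 \<le> s \<Longrightarrow> norm (v s) \<le> s powr - p"
  shows "norm (r t - r t0) \<le> t0 powr (1 - p) / (p - 1)"
proof (cases "t = t0")
  case True
  then show ?thesis using assms by simp
next
  case False
  \<comment> \<open>An antiderivative of \<open>s powr - p\<close>. Since \<open>p > 1\<close>, it
    is nowhere positive, so dropping \<open>\<phi> t\<close> from
    \<open>\<phi> t - \<phi> t0\<close> leaves a bound independent of \<open>t\<close>.\<close>
  define \<phi> where "\<phi> s = s powr (1 - p) / (1 - p)" for s
  have \<phi>: "(\<phi> has_vector_derivative s powr - p) (at s)" if "s > 0" for s
    using DERIV_cdivide[OF has_real_derivative_powr[OF that, of "1 - p"], of "1 - p"] \<open>1 < p\<close>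
    by (simp add: \<phi>_def[abs_def] has_real_derivative_iff_has_vector_derivative)
  have "norm (r t - r t0) \<le> \<phi> t - \<phi> t0"
  proof (rule differentiable_bound_general)
    show "t0 < t" using False assms by simp
    have "continuous_on {t0..} r"
      by (rule continuous_on_vector_derivative[of _ _ v]) (use r in simp)
    then show "continuous_on {t0..t} r"
      by (rule continuous_on_subset) auto
    show "continuous_on {t0..t} \<phi>"
      using assms by (auto simp: \<phi>_def intro!: continuous_intros)
    fix s assume s: "t0 < s" "s < t"
    \<comment> \<open>The mean value inequality asks for two-sided derivatives, but only at interior
      points; the endpoints are covered by continuity.\<close>
    have "at s within {t0..} = at s"
      using s by (intro at_within_interior) (simp add: interior_Ici[of "t0 - 1"])
    then show "(r has_vector_derivative v s) (at s)"
      using r[of s] s by simp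
    show "(\<phi> has_vector_derivative s powr - p) (at s)"
      using s assms by (intro \<phi>) simp
    show "norm (v s) \<le> s powr - p"
      using s by (intro v) simp
  qed
  also have "\<dots> \<le> - \<phi> t0"
    using \<open>1 < p\<close> by (simp add: \<phi>_def divide_nonneg_neg)
  also have "\<dots> = t0 powr (1 - p) / (p - 1)"
    by (simp add: \<phi>_def flip: divide_minus_right)
  finally show ?thesis .
qed

text \<open>Either form of decay makes \<open>t powr p * norm (P t r \<theta>)\<close> at most 1 for
  large \<open>t\<close>. In the majorant form, compactness gives \<open>norm r \<le> R\<close>, and
  monotonicity replaces \<open>\<alpha> (norm r)\<close> by the constant
  \<open>\<alpha> R\<close>.\<close>

lemma eventually_norm_le_powr:
  fixes P :: "real \<Rightarrow> real ^ 'm \<Rightarrow> real ^ 'n \<Rightarrow> real ^ 'k"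
  assumes "decay_uniform p P \<or> decay_majorant p P" and "compact K" and K: "K \<subseteq> orthant"
  shows "\<forall>\<^sub>F t in at_top. \<forall>r\<in>K. \<forall>\<theta>. norm (P t r \<theta>) \<le> t powr - p"
proof -
  have "\<forall>\<^sub>F t in at_top. \<forall>r\<in>K. \<forall>\<theta>. t powr p * norm (P t r \<theta>) \<le> 1"
    using assms(1)
  proof
    assume "decay_uniform p P"
    then have "uniform_limit (K \<times> UNIV) (\<lambda>t (r, \<theta>). t powr p * norm (P t r \<theta>)) (\<lambda>_. 0) at_top"
      using assms unfolding decay_uniform_def by blast
    then have "\<forall>\<^sub>F t in at_top. \<forall>x\<in>K \<times> UNIV. dist (case x of (r, \<theta>) \<Rightarrow> t powr p * norm (P t r \<theta>)) 0 < 1"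
      by (rule uniform_limitD) simp
    then show ?thesis
      by eventually_elim (auto simp: dist_real_def abs_less_iff intro: less_imp_le dest!: bspec)
  next
    assume "decay_majorant p P"
    then obtain \<alpha> \<beta> :: "real \<Rightarrow> real" where \<alpha>: "mono_on {0..} \<alpha>" "\<forall>s\<ge>0. 0 < \<alpha> s"
      and \<beta>: "\<forall>t\<ge>0. 0 < \<beta> t" "(\<beta> \<longlongrightarrow> 0) at_top"
      and le: "\<forall>t\<ge>0. \<forall>r\<in>orthant. \<forall>\<theta>. t powr p * norm (P t r \<theta>) \<le> \<alpha> (norm r) * \<beta> t"
      unfolding decay_majorant_def by blast
    obtain R where R: "0 < R" "\<And>r. r \<in> K \<Longrightarrow> norm r \<le> R"
      using compact_imp_bounded[OF \<open>compact K\<close>] unfolding bounded_pos by blast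
    have "((\<lambda>t. \<alpha> R * \<beta> t) \<longlongrightarrow> 0) at_top"
      using tendsto_mult_left[OF \<beta>(2), of "\<alpha> R"] by simp
    then have "\<forall>\<^sub>F t in at_top. \<alpha> R * \<beta> t < 1"
      by (rule order_tendstoD) simp
    then show ?thesis
      using eventually_ge_at_top[of 0]
    proof (eventually_elim, intro ballI allI)
      fix t :: real and r \<theta> assume t: "\<alpha> R * \<beta> t < 1" "0 \<le> t" and r: "r \<in> K"
      have "t powr p * norm (P t r \<theta>) \<le> \<alpha> (norm r) * \<beta> t"
        using le t r K by blast
      also have "\<dots> \<le> \<alpha> R * \<beta> t"
        using mono_onD[OF \<alpha>(1), of "norm r" R] R r \<beta>(1) t by (intro mult_right_mono) auto
      finally show "t powr p * norm (P t r \<theta>) \<le> 1"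
        using t by simp
    qed
  qed
  \<comment> \<open>Division by \<open>t powr p\<close> requires \<open>t > 0\<close>, because
    \<open>0 powr p\<close> is 0.\<close>
  then show ?thesis
    using eventually_gt_at_top[of 0]
    by eventually_elim (auto simp: powr_minus field_simps)
qed

section \<open>Construction of a solution confined to a ball\<close>

theorem theorem4p1:
  fixes A :: "real ^ 'm \<Rightarrow> real ^ 'n"
    and P :: "real \<Rightarrow> real ^ 'm \<Rightarrow> real ^ 'n \<Rightarrow> real ^ 'm"
    and Q :: "real \<Rightarrow> real ^ 'm \<Rightarrow> real ^ 'n \<Rightarrow> real ^ 'n"
    and \<omega> :: "real ^ 'n"
    and p :: real
  assumes "C1_on_orthant A"
    and "\<forall>r\<in>orthant. \<forall>k. 0 < A r $ k"
    and "C011 P"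
    and "C011 Q"
    and "\<forall>k. 0 < \<omega> $ k"
    and "torus_periodic \<omega> P"
    and "torus_periodic \<omega> Q"
    and "1 < p"
    and "decay_uniform p P \<or> decay_majorant p P"
  shows "\<exists>t0 r \<theta>. solves_system A P Q t0 r \<theta> \<and> bdd_above ((\<lambda>t. norm (r t)) ` {t0..})"
proof -
  define G where "G = (\<lambda>t r \<theta>. A r + Q t r \<theta>)"
  have G: "C011 G" "torus_periodic \<omega> G"
    using assms(1,4,7) by (auto simp: G_def C011_autonomous_add torus_periodic_def)
  define c :: "real ^ 'm" where "c = (\<chi> i. 1)"
  define K where "K = cball c (1/2)"
  have K: "compact K" "convex K" "closed K" "K \<noteq> {}" "c \<in> K"
    by (auto simp: K_def)
  have "K \<subseteq> orthant"
  proof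
    fix r assume "r \<in> K"
    have "0 \<le> r $ i" for i
    proof -
      have "\<bar>(c - r) $ i\<bar> \<le> norm (c - r)"
        by (rule component_le_norm_cart)
      then show ?thesis
        using \<open>r \<in> K\<close> by (simp add: K_def c_def dist_norm)
    qed
    then show "r \<in> orthant"
      by (simp add: orthant_def)
  qed
  define proj where "proj = closest_point K"
  \<comment> \<open>The nearest-point map of a closed convex set is nonexpansive, so Lipschitz
    bounds on \<open>K\<close> survive composition with it.\<close>
  have proj: "proj r \<in> K" "norm (proj r - proj r') \<le> norm (r - r')" for r r'
    using K closest_point_in_set[of K r] closest_point_lipschitz[of K r r']
    by (auto simp: proj_def dist_norm)
  have cont_proj: "continuous_on UNIV (\<lambda>x. f (fst x) (proj (fst (snd x))) (snd (snd x)))"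
    if "C011 f" for f :: "real \<Rightarrow> real ^ 'm \<Rightarrow> real ^ 'n \<Rightarrow> real ^ 'k"
  proof -
    have "continuous_on (UNIV \<times> orthant \<times> UNIV) (\<lambda>(t, r, \<theta>). f t r \<theta>)"
      using that by (simp add: C011_def)
    moreover have cproj: "continuous_on UNIV proj"
      using K unfolding proj_def by (intro continuous_on_closest_point)
    have "continuous_on UNIV (\<lambda>x::real \<times> (real ^ 'm) \<times> (real ^ 'n). (fst x, proj (fst (snd x)), snd (snd x)))"
      by (intro continuous_intros continuous_on_compose2[OF cproj]) auto
    ultimately have "continuous_on UNIV
        (\<lambda>x. case (fst x, proj (fst (snd x)), snd (snd x)) of (t, r, \<theta>) \<Rightarrow> f t r \<theta>)"
      by (rule continuous_on_compose2) (use proj \<open>K \<subseteq> orthant\<close> in auto)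
    then show ?thesis by simp
  qed
  define F where "F t x = (P t (proj (fst x)) (snd x), G t (proj (fst x)) (snd x))" for t x
  have "\<forall>\<^sub>F t in at_top. \<forall>r\<in>K. \<forall>\<theta>. norm (P t r \<theta>) \<le> t powr - p"
    using assms(9) K(1) \<open>K \<subseteq> orthant\<close> by (rule eventually_norm_le_powr)
  then obtain t1 where t1: "\<And>t r \<theta>. t1 \<le> t \<Longrightarrow> r \<in> K \<Longrightarrow> norm (P t r \<theta>) \<le> t powr - p"
    unfolding eventually_at_top_linorder by blast
  have "((\<lambda>t. t powr (1 - p) / (p - 1)) \<longlongrightarrow> 0) at_top"
    using tendsto_neg_powr[of "1 - p" "\<lambda>t. t"] \<open>1 < p\<close>
    by (intro tendsto_divide_zero) (auto simp: filterlim_ident)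
  then have "\<forall>\<^sub>F t in at_top. t powr (1 - p) / (p - 1) < 1 / 2"
    by (rule order_tendstoD) simp
  \<comment> \<open>Three demands on the starting time: the tail is below the radius of
    \<open>K\<close>, the decay bound is in force, and the powers are taken of positive
    numbers.\<close>
  then have "\<forall>\<^sub>F t in at_top. t powr (1 - p) / (p - 1) < 1 / 2 \<and> t1 \<le> t \<and> 0 < t"
    using eventually_ge_at_top[of t1] eventually_gt_at_top[of 0] by eventually_elim simp
  then obtain t0 where t0: "t0 powr (1 - p) / (p - 1) < 1 / 2" "t1 \<le> t0" "0 < t0"
    using eventually_happens'[OF trivial_limit_at_top_linorder] by blast
  have contF: "continuous_on ({t0..} \<times> UNIV) (\<lambda>(t, x). F t x)"
    unfolding F_def case_prod_unfold
    by (intro continuous_on_Pair continuous_on_subset[OF cont_proj] assms(3) G(1)) auto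
  have lipF: "\<exists>L. \<forall>t\<in>{t0..T}. \<forall>x y. norm (F t x - F t y) \<le> L * norm (x - y)" for T
  proof -
    obtain L1 where L1: "L1 \<ge> 0" "\<forall>t\<in>{t0..T}. \<forall>r\<in>K. \<forall>r'\<in>K. \<forall>\<theta> \<theta>'.
        norm (P t r \<theta> - P t r' \<theta>') \<le> L1 * (norm (r - r') + norm (\<theta> - \<theta>'))"
      using C011_lipschitz[OF assms(3,6,5) K(1,2) \<open>K \<subseteq> orthant\<close>] by blast
    obtain L2 where L2: "L2 \<ge> 0" "\<forall>t\<in>{t0..T}. \<forall>r\<in>K. \<forall>r'\<in>K. \<forall>\<theta> \<theta>'.
        norm (G t r \<theta> - G t r' \<theta>') \<le> L2 * (norm (r - r') + norm (\<theta> - \<theta>'))"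
      using C011_lipschitz[OF G assms(5) K(1,2) \<open>K \<subseteq> orthant\<close>] by blast
    show ?thesis
    proof (intro exI ballI allI)
      fix t and x y :: "(real ^ 'm) \<times> (real ^ 'n)"
      assume t: "t \<in> {t0..T}"
      have "norm (proj (fst x) - proj (fst y)) \<le> norm (x - y)" "norm (snd x - snd y) \<le> norm (x - y)"
        using proj(2)[of "fst x" "fst y"] dist_fst_le[of x y] dist_snd_le[of x y]
        by (auto simp: dist_norm)
      \<comment> \<open>The factor 2 passes from the sum of the component norms to the norm of the
        product space.\<close>
      then have d: "norm (proj (fst x) - proj (fst y)) + norm (snd x - snd y) \<le> 2 * norm (x - y)"
        by simp
      have "norm (F t x - F t y) \<le> norm (P t (proj (fst x)) (snd x) - P t (proj (fst y)) (snd y))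
              + norm (G t (proj (fst x)) (snd x) - G t (proj (fst y)) (snd y))"
        by (simp add: F_def norm_Pair_le)
      also have "\<dots> \<le> L1 * (norm (proj (fst x) - proj (fst y)) + norm (snd x - snd y))
              + L2 * (norm (proj (fst x) - proj (fst y)) + norm (snd x - snd y))"
        using L1(2) L2(2) t proj(1) by (intro add_mono) blast+
      also have "\<dots> \<le> L1 * (2 * norm (x - y)) + L2 * (2 * norm (x - y))"
        using d L1(1) L2(1) by (intro add_mono mult_left_mono)
      also have "\<dots> = (2 * (L1 + L2)) * norm (x - y)"
        by (simp add: algebra_simps)
      finally show "norm (F t x - F t y) \<le> (2 * (L1 + L2)) * norm (x - y)" .
    qed
  qed
  obtain x where x0: "x t0 = (c, 0)"
    and x: "\<And>t. t0 \<le> t \<Longrightarrow> (x has_vector_derivative F t (x t)) (at t within {t0..})"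
    using global_solution_of_lipschitz_ode[OF contF lipF] by blast
  define r \<theta> where "r t = fst (x t)" and "\<theta> t = snd (x t)" for t
  have r: "(r has_vector_derivative P t (proj (r t)) (\<theta> t)) (at t within {t0..})"
    and \<theta>: "(\<theta> has_vector_derivative G t (proj (r t)) (\<theta> t)) (at t within {t0..})"
    if "t0 \<le> t" for t
    using bounded_linear.has_vector_derivative[OF bounded_linear_fst x[OF that]]
      bounded_linear.has_vector_derivative[OF bounded_linear_snd x[OF that]]
    by (simp_all add: F_def r_def[abs_def] \<theta>_def[abs_def])
  \<comment> \<open>No continuation argument is involved: the velocity is \<open>P\<close> at the
    projected point, which lies in \<open>K\<close> wherever \<open>r t\<close> may be, so the decay
    bound holds at all times in advance.\<close>
  have rK: "r t \<in> K" if "t0 \<le> t" for t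
  proof -
    have "norm (r t - r t0) \<le> t0 powr (1 - p) / (p - 1)"
      using t0 \<open>1 < p\<close> that proj(1) by (intro norm_increment_le_powr_tail[OF _ _ _ r] t1) auto
    then have "norm (r t - c) \<le> 1 / 2"
      using t0(1) x0 by (simp only: r_def fst_conv)
    then show ?thesis
      by (simp add: K_def dist_norm norm_minus_commute)
  qed
  then have "proj (r t) = r t" if "t0 \<le> t" for t
    using that by (simp add: proj_def closest_point_self)
  with r \<theta> rK \<open>K \<subseteq> orthant\<close> have "solves_system A P Q t0 r \<theta>"
    unfolding solves_system_def G_def by auto
  moreover have "bounded (r ` {t0..})"
    using rK by (intro bounded_subset[OF compact_imp_bounded[OF K(1)]]) auto
  then have "bdd_above ((\<lambda>t. norm (r t)) ` {t0..})"
    by (auto simp: bounded_iff bdd_above_def)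
  ultimately show ?thesis by blast
qed

end
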